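(* $\tilde{\mathcal P}_+=\tilde{\mathcal P}_-=\tilde{\mathcal P}_{cons}$.
   Context: For $\varepsilon\in\{-1,1\}$ and positive integers $n>m$, $D_\varepsilon(n,m)=n^n+\varepsilon (n-m)^{n-m}m^m$. For $\varepsilon\in\{-1,1\}$, $\tilde{\mathcal P}_\varepsilon$ is the set of primes $p$ for which there exist positive integers $n>m$ with $p\nmid m$ such that $p^2\mid D_\varepsilon(n,m)$ but $p^2\nmid \frac{n^2-mn+m^2}{\gcd(m,n)^2}$; write $\tilde{\mathcal P}_\pm$ for $\tilde{\mathcal P}_{\pm1}$. An integer $x$ is a nonzero $p$th power modulo $p^2$ if $x\equiv a^p\pmod{p^2}$ for some integer $a$ and $p\nmid x$; two $p$th powers $x,y$ modulo $p^2$ are consecutive if $y-x\equiv\pm1\pmod{p^2}$. $\tilde{\mathcal P}_{cons}$ is the set of primes $p$ for which there exists a pair of consecutive nonzero $p$th powers modulo $p^2$ other than a pair $(x-1,x)$ where $x$ is a primitive sixth root of unity modulo $p^2$.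
   Formalization: In P̃_ε the condition "p² ∤ (n²−mn+m²)/gcd(m,n)²" is replaced by "p ∤ (n²−mn+m²)/gcd(m,n)²"; as printed, 7 lies in P̃_+ (n=5, m=1) but not in P̃_cons. Pairs of consecutive powers are taken as unordered. *)

theory Defs
  imports "HOL-Number_Theory.Number_Theory"
begin

definition D :: "int \<Rightarrow> nat \<Rightarrow> nat \<Rightarrow> int" where
  "D \<epsilon> n m = int n ^ n + \<epsilon> * (int (n - m) ^ (n - m) * int m ^ m)"

text \<open>
  The division is exact. The source requires \<open>p\<^sup>2\<close>, rather than \<open>p\<close>, not to divide the quotient
  \<open>q = (n\<^sup>2 - m n + m\<^sup>2) / gcd(m,n)\<^sup>2\<close>. With that wording
  7 would belong to \<open>P_tilde 1\<close> but not to \<open>P_cons_tilde\<close>: \<open>D 1 5 1 = 3381 = 7\<^sup>2 * 69\<close> and \<open>q = 21\<close>, although the only consecutive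
  nonzero 7th powers modulo 49 are the pairs \<open>(18,19)\<close> and \<open>(30,31)\<close>, where 19 and 31 are the
  primitive sixth roots of unity. The divisors to be excluded are those with
  \<open>p\<^sup>2\<close> dividing \<open>q\<^sup>2\<close>, that is, with \<open>p\<close> dividing \<open>q\<close>.
\<close>

definition P_tilde :: "int \<Rightarrow> nat set" where
  "P_tilde \<epsilon> = {p. prime p \<and>
     (\<exists>n m :: nat. 0 < m \<and> m < n \<and> \<not> p dvd m \<and>
        int p ^ 2 dvd D \<epsilon> n m \<and>
        \<not> int p dvd (int n ^ 2 - int m * int n + int m ^ 2) div int (gcd m n) ^ 2)}"

definition nonzero_pth_power :: "nat \<Rightarrow> int \<Rightarrow> bool" where
  "nonzero_pth_power p x \<longleftrightarrow> (\<exists>a::int. [x = a ^ p] (mod int p ^ 2)) \<and> \<not> int p dvd x"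

definition consecutive :: "nat \<Rightarrow> int \<Rightarrow> int \<Rightarrow> bool" where
  "consecutive p x y \<longleftrightarrow> [y - x = 1] (mod int p ^ 2) \<or> [y - x = -1] (mod int p ^ 2)"

text \<open>
  Pairs are unordered pairs of residue classes: as \<open>consecutive\<close> is symmetric, the pair \<open>(z, z - 1)\<close>
  has to be excluded together with \<open>(z - 1, z)\<close>. The number \<open>z\<close> is a representative of its class;
  \<open>ord (p\<^sup>2) z = 6\<close> says that this class has multiplicative order exactly 6.
\<close>

definition sixth_root_pair :: "nat \<Rightarrow> int \<Rightarrow> int \<Rightarrow> bool" where
  "sixth_root_pair p x y \<longleftrightarrow> (\<exists>z::nat. ord (p ^ 2) z = 6 \<and>
     ([x = int z - 1] (mod int p ^ 2) \<and> [y = int z] (mod int p ^ 2) \<or>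
      [y = int z - 1] (mod int p ^ 2) \<and> [x = int z] (mod int p ^ 2)))"

definition P_cons_tilde :: "nat set" where
  "P_cons_tilde = {p. prime p \<and>
     (\<exists>x y :: int. nonzero_pth_power p x \<and> nonzero_pth_power p y \<and>
        consecutive p x y \<and> \<not> sixth_root_pair p x y)}"

end

theory Submission
  imports Defs
begin

text \<open>
  Put \<open>k = n - m\<close>. If \<open>p\<^sup>2\<close> divides \<open>D \<epsilon> n m\<close> then \<open>p\<close> is odd and divides none of \<open>k\<close>, \<open>m\<close>, \<open>n\<close>.
  For units, \<open>u = v\<close> modulo \<open>p\<^sup>2\<close> means that \<open>u = v\<close> modulo \<open>p\<close> and that \<open>u\<close> and \<open>v\<close> have the
  same Fermat quotient modulo \<open>p\<close>. Equality of the Fermat quotients of \<open>n\<^sup>n\<close> and of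
  \<open>- \<epsilon> k\<^sup>k m\<^sup>m\<close> amounts to \<open>n\<^sup>p = k\<^sup>p + m\<^sup>p\<close> modulo \<open>p\<^sup>2\<close>, that is, to \<open>a\<^sup>p\<close> and \<open>(a - 1)\<^sup>p\<close> being
  consecutive for \<open>a = n / m\<close>. Conversely, given such an \<open>a\<close>, the Chinese remainder theorem lets
  the residues of \<open>n\<close> and \<open>m\<close> modulo \<open>p\<close> and modulo \<open>p - 1\<close> be chosen independently, so that only
  \<open>a\<^sup>N = - \<epsilon> (a - 1)\<^sup>K\<close> modulo \<open>p\<close> has to be solved for exponents \<open>N\<close> and \<open>K\<close>. This is trivial for
  \<open>\<epsilon> = -1\<close>. For \<open>\<epsilon> = 1\<close> it is possible when \<open>-1\<close> is a power of \<open>a\<close>; otherwise \<open>a\<close> has odd order, and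
  \<open>a\<close> is replaced by \<open>1 - a\<close>, for which \<open>(1 - a) - 1 = - a\<close> has \<open>-1\<close> among its powers.
  The condition on the sixth roots of unity is \<open>p\<close> not dividing \<open>a\<^sup>2 - a + 1\<close> on both sides.
\<close>

section \<open>Powers modulo \<open>p\<close> and modulo \<open>p ^ 2\<close>\<close>

lemma cong_pow_self_square:
  fixes x y :: int
  assumes "[x = y] (mod int n)"
  shows "[x ^ n = y ^ n] (mod int n ^ 2)"
proof -
  \<comment> \<open>The cofactor of \<open>x - y\<close> in \<open>x ^ n - y ^ n\<close> is modulo
    \<open>n\<close> a sum of \<open>n\<close> equal terms; this supplies the second factor
    \<open>n\<close>.\<close>
  have "[(\<Sum>i<n. y ^ (n - Suc i) * x ^ i) = (\<Sum>i<n. y ^ (n - Suc i) * y ^ i)] (mod int n)"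
    by (intro cong_sum cong_mult cong_pow assms cong_refl)
  also have "(\<Sum>i<n. y ^ (n - Suc i) * y ^ i) = (\<Sum>i<n. y ^ (n - 1))"
    by (intro sum.cong) (auto simp flip: power_add)
  finally have "[(\<Sum>i<n. y ^ (n - Suc i) * x ^ i) = int n * y ^ (n - 1)] (mod int n)"
    by simp
  then have "int n dvd (\<Sum>i<n. y ^ (n - Suc i) * x ^ i)"
    by (simp add: cong_dvd_iff)
  moreover have "int n dvd x - y"
    using assms by (simp add: cong_iff_dvd_diff)
  ultimately have "int n * int n dvd (x - y) * (\<Sum>i<n. y ^ (n - Suc i) * x ^ i)"
    by (rule mult_dvd_mono[rotated])
  then show ?thesis
    by (simp add: cong_iff_dvd_diff power_diff_sumr2 power2_eq_square)
qed

lemma cong_one_plus_power: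
  fixes q r :: int
  shows "[(1 + r * q) ^ n = 1 + r * (int n * q)] (mod r ^ 2)"
proof (induction n)
  case (Suc n)
  have "[(1 + r * q) ^ Suc n = (1 + r * q) * (1 + r * (int n * q))] (mod r ^ 2)"
    using Suc by (simp add: cong_mult)
  also have "(1 + r * q) * (1 + r * (int n * q))
      = 1 + r * (int (Suc n) * q) + r ^ 2 * (int n * q * q)"
    by (simp add: algebra_simps power2_eq_square)
  also have "[\<dots> = 1 + r * (int (Suc n) * q)] (mod r ^ 2)"
    by (simp add: cong_iff_dvd_diff)
  finally show ?case .
qed simp

lemma fermat_theorem_int:
  assumes "prime p" "\<not> int p dvd a"
  shows "[a ^ (p - 1) = 1] (mod int p)"
proof -
  have p: "int p > 0"
    using assms(1) prime_gt_0_nat by simp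
  define b where "b = nat (a mod int p)"
  have b: "int b = a mod int p"
    using p by (simp add: b_def)
  then have "\<not> p dvd b"
    using assms(2) by (metis dvd_mod_iff dvd_refl int_dvd_int_iff)
  then have "[int b ^ (p - 1) = 1] (mod int p)"
    using fermat_theorem[OF assms(1)] by (metis cong_int_iff of_nat_1 of_nat_power)
  then show ?thesis
    by (simp add: b cong_def power_mod)
qed

lemma cong_pow_prime_int:
  assumes "prime p"
  shows "[a ^ p = a] (mod int p)"
proof (cases "int p dvd a")
  case True
  moreover from this have "int p dvd a ^ p"
    using prime_gt_0_nat[OF assms] by (meson dvd_power dvd_trans)
  ultimately show ?thesis
    by (simp add: cong_iff_dvd_diff)
next
  case False
  then have "[a * a ^ (p - 1) = a * 1] (mod int p)"
    by (intro cong_mult cong_refl fermat_theorem_int assms)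
  then show ?thesis
    using prime_gt_0_nat[OF assms] by (simp add: power_eq_if)
qed

lemma cong_pow_exponent:
  assumes "prime p" "\<not> int p dvd a" "[e = f] (mod (p - 1))"
  shows "[a ^ e = a ^ f] (mod int p)"
proof -
  have aux: "[a ^ e = a ^ (e mod (p - 1))] (mod int p)" for e
  proof -
    have "[(a ^ (p - 1)) ^ (e div (p - 1)) * a ^ (e mod (p - 1))
        = 1 ^ (e div (p - 1)) * a ^ (e mod (p - 1))] (mod int p)"
      by (intro cong_mult cong_pow cong_refl fermat_theorem_int assms)
    then show ?thesis
      by (simp flip: power_mult power_add)
  qed
  show ?thesis
    using aux[of e] aux[of f] assms(3) by (metis cong_def cong_sym cong_trans)
qed

section \<open>Fermat quotients and the divisibility of \<open>D\<close> by
  \<open>p ^ 2\<close>\<close>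

lemma coprime_prime_square:
  assumes "prime p" "\<not> int p dvd x"
  shows "coprime x (int p ^ 2)"
  using assms by (metis coprime_commute coprime_power_right_iff prime_imp_coprime prime_nat_int_transfer)

lemma prime_int_dvd_powerD: "prime p \<Longrightarrow> int p dvd x ^ n \<Longrightarrow> int p dvd x"
  using prime_dvd_power[of "int p" x n] by simp

text \<open>The residue of \<open>u\<close> modulo \<open>p\<close> determines
  \<open>u ^ p = u * u ^ (p - 1)\<close> modulo \<open>p ^ 2\<close>; cancelling the common unit
  \<open>v ^ (p - 1)\<close> recovers \<open>u\<close>.\<close>

lemma cong_prime_square_iff:
  assumes p: "prime p" and v: "\<not> int p dvd v"
  shows "[u = v] (mod int p ^ 2) \<longleftrightarrow>
    [u = v] (mod int p) \<and> [u ^ (p - 1) = v ^ (p - 1)] (mod int p ^ 2)"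
proof safe
  assume "[u = v] (mod int p ^ 2)"
  then show "[u = v] (mod int p)" "[u ^ (p - 1) = v ^ (p - 1)] (mod int p ^ 2)"
    by (auto intro: cong_pow elim: cong_dvd_modulus)
next
  assume uv: "[u = v] (mod int p)" and *: "[u ^ (p - 1) = v ^ (p - 1)] (mod int p ^ 2)"
  have eq: "x ^ p = x * x ^ (p - 1)" for x :: int
    using prime_gt_0_nat[OF p] by (simp add: power_eq_if)
  have "[u * v ^ (p - 1) = u * u ^ (p - 1)] (mod int p ^ 2)"
    using * by (intro cong_mult cong_refl) (rule cong_sym)
  also have "[u * u ^ (p - 1) = v * v ^ (p - 1)] (mod int p ^ 2)"
    using cong_pow_self_square[OF uv] by (simp add: eq)
  finally have "[u * v ^ (p - 1) = v * v ^ (p - 1)] (mod int p ^ 2)" .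
  moreover have "coprime (v ^ (p - 1)) (int p ^ 2)"
    using coprime_prime_square[OF p v] by simp
  ultimately show "[u = v] (mod int p ^ 2)"
    by (simp add: cong_mult_rcancel)
qed

text \<open>If \<open>x ^ (p - 1) = 1 + p * q\<close>, then \<open>(x ^ x) ^ (p - 1)\<close> is
  \<open>1 + p * x * q\<close> modulo \<open>p ^ 2\<close>, while
  \<open>x ^ p = x + p * x * q\<close>. In the second congruence the terms without \<open>p\<close>
  cancel, so both say that \<open>p\<close> divides the same combination \<open>s\<close> of the
  three quotients.\<close>

lemma cong_fermat_quotients_iff:
  fixes k m :: nat
  assumes p: "prime p" and k: "\<not> p dvd k" and m: "\<not> p dvd m" and n: "\<not> p dvd k + m"
  shows "[(int (k + m) ^ (k + m)) ^ (p - 1) = (int k ^ k * int m ^ m) ^ (p - 1)] (mod int p ^ 2)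
    \<longleftrightarrow> [int (k + m) ^ p = int k ^ p + int m ^ p] (mod int p ^ 2)"
proof -
  have ex: "\<exists>q. int a ^ (p - 1) = 1 + int p * q" if "\<not> p dvd a" for a
  proof -
    have "int p dvd int a ^ (p - 1) - 1"
      using fermat_theorem_int[OF p, of "int a"] that by (simp add: cong_iff_dvd_diff)
    then obtain q where "int a ^ (p - 1) - 1 = int p * q" ..
    then show ?thesis
      by (intro exI[of _ q]) simp
  qed
  obtain qk qm qn where q: "int k ^ (p - 1) = 1 + int p * qk" "int m ^ (p - 1) = 1 + int p * qm"
      "int (k + m) ^ (p - 1) = 1 + int p * qn"
    using ex[OF k] ex[OF m] ex[OF n] by blast
  define s where "s = int (k + m) * qn - int k * qk - int m * qm"
  have eq: "x ^ p = x * x ^ (p - 1)" for x :: int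
    using prime_gt_0_nat[OF p] by (simp add: power_eq_if)
  have pow: "[(int a ^ a) ^ (p - 1) = 1 + int p * (int a * q)] (mod int p ^ 2)"
    if "int a ^ (p - 1) = 1 + int p * q" for a q
  proof -
    have "(int a ^ a) ^ (p - 1) = (int a ^ (p - 1)) ^ a"
      by (metis mult.commute power_mult)
    then show ?thesis
      using cong_one_plus_power[of "int p" q a] that by simp
  qed
  have "[(int k ^ k * int m ^ m) ^ (p - 1)
      = (1 + int p * (int k * qk)) * (1 + int p * (int m * qm))] (mod int p ^ 2)"
    unfolding power_mult_distrib by (intro cong_mult pow q)
  also have "(1 + int p * (int k * qk)) * (1 + int p * (int m * qm))
      = 1 + int p * (int k * qk + int m * qm) + int p ^ 2 * (int k * qk * int m * qm)"
    by (simp add: algebra_simps power2_eq_square)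
  also have "[\<dots> = 1 + int p * (int k * qk + int m * qm)] (mod int p ^ 2)"
    unfolding cong_iff_dvd_diff add_diff_cancel_left' by (rule dvd_triv_left)
  finally have "[(int (k + m) ^ (k + m)) ^ (p - 1) = (int k ^ k * int m ^ m) ^ (p - 1)] (mod int p ^ 2)
    \<longleftrightarrow> [1 + int p * (int (k + m) * qn) = 1 + int p * (int k * qk + int m * qm)] (mod int p ^ 2)"
    using pow[OF q(3)] by (simp only: cong_def)
  also have "\<dots> \<longleftrightarrow> int p ^ 2 dvd int p * s"
    by (simp add: cong_iff_dvd_diff s_def algebra_simps)
  also have "int p * s = int (k + m) ^ p - (int k ^ p + int m ^ p)"
    unfolding eq q s_def by (simp add: algebra_simps)
  finally show ?thesis
    by (simp add: cong_iff_dvd_diff)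
qed

text \<open>Since \<open>p - 1\<close> is even, the sign drops out of the Fermat quotients:
  \<open>\<epsilon>\<close> survives only in the congruence modulo \<open>p\<close>.\<close>

lemma prime_square_dvd_D_iff:
  fixes k m :: nat
  assumes p: "prime p" "odd p" and \<epsilon>: "\<epsilon> = 1 \<or> \<epsilon> = -1"
    and k: "\<not> p dvd k" and m: "\<not> p dvd m" and n: "\<not> p dvd k + m"
  shows "int p ^ 2 dvd D \<epsilon> (k + m) m \<longleftrightarrow>
    [int (k + m) ^ (k + m) = - \<epsilon> * (int k ^ k * int m ^ m)] (mod int p) \<and>
    [int (k + m) ^ p = int k ^ p + int m ^ p] (mod int p ^ 2)"
proof -
  have pi: "prime (int p)"
    using p by simp
  have "\<not> int p dvd int k ^ k * int m ^ m"
    using k m pi by (auto simp: prime_dvd_mult_iff dest!: prime_int_dvd_powerD[OF p(1)])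
  then have unit: "\<not> int p dvd - \<epsilon> * (int k ^ k * int m ^ m)"
    using \<epsilon> by auto
  have "even (p - 1)"
    using p by simp
  then have "(- \<epsilon> * (int k ^ k * int m ^ m)) ^ (p - 1) = (int k ^ k * int m ^ m) ^ (p - 1)"
    using \<epsilon> by (auto simp: power_mult_distrib)
  moreover have "int p ^ 2 dvd D \<epsilon> (k + m) m
      \<longleftrightarrow> [int (k + m) ^ (k + m) = - \<epsilon> * (int k ^ k * int m ^ m)] (mod int p ^ 2)"
    by (simp add: D_def cong_iff_dvd_diff)
  ultimately show ?thesis
    using cong_prime_square_iff[OF p(1) unit] cong_fermat_quotients_iff[OF p(1) k m n] by simp
qed

section \<open>Bases of consecutive \<open>p\<close>-th powers\<close>

text \<open>The last condition uses the sixth cyclotomic polynomial, whose homogeneous form in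
  \<open>n\<close> and \<open>m\<close> is the numerator in \<open>P_tilde\<close>.\<close>

definition cons_base :: "nat \<Rightarrow> int \<Rightarrow> bool" where
  "cons_base p a \<longleftrightarrow> \<not> int p dvd a \<and> \<not> int p dvd a - 1 \<and>
     [a ^ p - (a - 1) ^ p = 1] (mod int p ^ 2) \<and> \<not> int p dvd a ^ 2 - a + 1"

lemma cons_base_odd: "cons_base p a \<Longrightarrow> prime p \<Longrightarrow> odd p"
  using primes_dvd_imp_eq[of 2 p] by (auto simp: cons_base_def)

text \<open>For odd \<open>p\<close>, passing to \<open>1 - a\<close> negates and swaps the two
  \<open>p\<close>-th powers, which preserves their difference; \<open>a ^ 2 - a + 1\<close> is
  invariant.\<close>

lemma cons_base_reflect:
  assumes "cons_base p a" "prime p"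
  shows "cons_base p (1 - a)"
proof -
  have odd: "odd p"
    using assms by (rule cons_base_odd)
  have "(1 - a) ^ p = - ((a - 1) ^ p)"
    using power_minus_odd[OF odd, of "a - 1"] by simp
  then have 1: "(1 - a) ^ p - (1 - a - 1) ^ p = a ^ p - (a - 1) ^ p"
    using odd by simp
  have 2: "(1 - a) ^ 2 - (1 - a) + 1 = a ^ 2 - a + 1"
    by (simp add: power2_eq_square algebra_simps)
  show ?thesis
    using assms(1) unfolding cons_base_def 1 2 by (simp add: dvd_diff_commute)
qed

section \<open>From \<open>n\<close> and \<open>m\<close> to a base \<open>a\<close>\<close>

lemma dvd_div_gcd_square_iff:
  fixes m n :: nat
  assumes p: "prime p" and m: "\<not> p dvd m"
  shows "int p dvd (int n ^ 2 - int m * int n + int m ^ 2) div int (gcd m n) ^ 2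
    \<longleftrightarrow> int p dvd int n ^ 2 - int m * int n + int m ^ 2"
proof -
  define g where "g = gcd m n"
  obtain n' m' where nm: "n = g * n'" "m = g * m'"
    unfolding g_def by (meson dvdE gcd_dvd1 gcd_dvd2)
  \<comment> \<open>The gcd divides \<open>m\<close>, so dividing by its square does not affect
    divisibility by \<open>p\<close>.\<close>
  have g: "\<not> p dvd g"
    using m nm by auto
  then have "g \<noteq> 0"
    by (metis dvd_0_right)
  have eq: "int n ^ 2 - int m * int n + int m ^ 2
      = int g ^ 2 * (int n' ^ 2 - int m' * int n' + int m' ^ 2)"
    by (simp add: nm power2_eq_square algebra_simps)
  have "\<not> int p dvd int g ^ 2"
    using g p by (metis int_dvd_int_iff prime_dvd_power prime_nat_int_transfer)
  then show ?thesis
    unfolding g_def[symmetric] eq using \<open>g \<noteq> 0\<close> p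
    by (simp add: prime_dvd_mult_iff)
qed

lemma cons_base_if_P_tilde:
  assumes \<epsilon>: "\<epsilon> = 1 \<or> \<epsilon> = -1" and "p \<in> P_tilde \<epsilon>"
  shows "prime p \<and> (\<exists>a. cons_base p a)"
proof -
  obtain n m where p: "prime p" and nm: "0 < m" "m < n" "\<not> p dvd m"
    and D: "int p ^ 2 dvd D \<epsilon> n m"
    and "\<not> int p dvd (int n ^ 2 - int m * int n + int m ^ 2) div int (gcd m n) ^ 2"
    using assms by (auto simp: P_tilde_def)
  then have sixth: "\<not> int p dvd int n ^ 2 - int m * int n + int m ^ 2"
    by (simp add: dvd_div_gcd_square_iff)
  define k where "k = n - m"
  have n: "n = k + m" and k0: "k > 0"
    using nm by (simp_all add: k_def)
  have pi: "prime (int p)"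
    using p by simp
  have "int p dvd D \<epsilon> n m"
    using D by (metis dvd_power dvd_trans pos2)
  then have Dp: "int p dvd int n ^ n + \<epsilon> * (int k ^ k * int m ^ m)"
    by (simp add: D_def k_def)
  have k: "\<not> p dvd k"
  proof
    assume "p dvd k"
    then have "int p dvd \<epsilon> * (int k ^ k * int m ^ m)"
      using k0 by (intro dvd_mult dvd_mult2) (auto intro: dvd_power dvd_trans)
    then have "int p dvd int n ^ n"
      using Dp by (simp add: dvd_add_left_iff)
    then have "p dvd n"
      using pi by (metis int_dvd_int_iff prime_dvd_power)
    then show False
      using \<open>p dvd k\<close> nm(3) n by (simp add: dvd_add_right_iff)
  qed
  have n': "\<not> p dvd n"
  proof
    assume "p dvd n"
    then have "int p dvd int n ^ n"
      using nm by (auto intro: dvd_power dvd_trans)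
    then have "int p dvd \<epsilon> * (int k ^ k * int m ^ m)"
      using Dp by (simp add: dvd_add_right_iff)
    then have "int p dvd int k \<or> int p dvd int m"
      using pi \<epsilon> by (auto simp: prime_dvd_mult_iff dest!: prime_int_dvd_powerD[OF p])
    then show False
      using k nm by simp
  qed
  \<comment> \<open>For \<open>p = 2\<close> both \<open>k\<close> and \<open>m\<close> would be
    odd, making \<open>n\<close> even.\<close>
  have odd: "odd p"
  proof
    assume "even p"
    then have "p = 2"
      using p primes_dvd_imp_eq[of 2 p] by simp
    then show False
      using k nm(3) n n' by simp
  qed
  have sum: "[int n ^ p = int k ^ p + int m ^ p] (mod int p ^ 2)"
    using D k nm n' unfolding n by (simp add: prime_square_dvd_D_iff[OF p odd \<epsilon>])
  have "coprime (int m) (int p ^ 2)"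
    using nm by (intro coprime_prime_square p) simp
  then obtain w where w: "[int m * w = 1] (mod int p ^ 2)"
    using cong_solve_coprime_int by blast
  then have w': "[int m * w = 1] (mod int p)"
    by (rule cong_dvd_modulus) simp
  have pw: "\<not> int p dvd w"
    using cong_dvd_iff[OF w'] pi by auto
  \<comment> \<open>As \<open>w\<close> inverts \<open>m\<close>, this is \<open>n / m\<close>, and
    \<open>a - 1\<close> is \<open>k / m\<close> modulo \<open>p ^ 2\<close>.\<close>
  define a where "a = w * int n"
  have a1: "[a - 1 = w * int k] (mod int p ^ 2)"
    using cong_diff[OF cong_refl[of a] cong_sym[OF w]] by (simp add: a_def n algebra_simps cong_sym)
  then have a1': "[a - 1 = w * int k] (mod int p)"
    by (rule cong_dvd_modulus) simp
  have "[a ^ p - (a - 1) ^ p = w ^ p * (int k ^ p + int m ^ p) - (w * int k) ^ p] (mod int p ^ 2)"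
    unfolding a_def power_mult_distrib[of w "int n"]
    using a1[unfolded a_def] by (intro cong_diff cong_mult cong_refl cong_pow sum)
  also have "w ^ p * (int k ^ p + int m ^ p) - (w * int k) ^ p = (int m * w) ^ p"
    by (simp add: algebra_simps power_mult_distrib)
  also have "[(int m * w) ^ p = 1 ^ p] (mod int p ^ 2)"
    using w by (rule cong_pow)
  finally have 1: "[a ^ p - (a - 1) ^ p = 1] (mod int p ^ 2)"
    by simp
  have 2: "\<not> int p dvd a" "\<not> int p dvd a - 1"
    using pw n' k pi by (simp_all add: cong_dvd_iff[OF a1'] prime_dvd_mult_iff, simp add: a_def prime_dvd_mult_iff)
  \<comment> \<open>Writing 1 as \<open>m * w\<close> makes the polynomial homogeneous, so that
    \<open>w ^ 2\<close> factors out.\<close>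
  have "[a ^ 2 - a * 1 + 1 ^ 2 = a ^ 2 - a * (int m * w) + (int m * w) ^ 2] (mod int p)"
    using w' by (intro cong_diff cong_add cong_mult cong_pow cong_refl) (simp_all add: cong_sym)
  also have "a ^ 2 - a * (int m * w) + (int m * w) ^ 2
      = w ^ 2 * (int n ^ 2 - int m * int n + int m ^ 2)"
    by (simp add: a_def power2_eq_square algebra_simps)
  finally have "int p dvd a ^ 2 - a + 1
      \<longleftrightarrow> int p dvd w ^ 2 * (int n ^ 2 - int m * int n + int m ^ 2)"
    by (simp add: cong_dvd_iff)
  also have "\<not> \<dots>"
    using pw sixth pi by (auto simp: prime_dvd_mult_iff dest!: prime_int_dvd_powerD[OF p])
  finally show ?thesis
    using p 1 2 by (auto simp: cons_base_def)
qed

section \<open>From a base \<open>a\<close> to \<open>n\<close> and \<open>m\<close>\<close>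

lemma P_tilde_if_cons_base:
  assumes \<epsilon>: "\<epsilon> = 1 \<or> \<epsilon> = -1" and p: "prime p" and a: "cons_base p a"
    and NK: "[a ^ N = - \<epsilon> * (a - 1) ^ K] (mod int p)"
  shows "p \<in> P_tilde \<epsilon>"
proof -
  have odd: "odd p"
    using a p by (rule cons_base_odd)
  then have p2: "p \<ge> 2"
    using prime_ge_2_nat[OF p] by simp
  have cop: "coprime p (p - 1)"
    using p2 coprime_diff_one_right_nat[of p] by simp
  obtain k where k: "[k = nat ((a - 1) mod int p)] (mod p)" "[k = K] (mod (p - 1))"
    using binary_chinese_remainder_nat[OF cop] by blast
  \<comment> \<open>\<open>N + K * (p - 2)\<close> stands for \<open>N - K\<close> modulo
    \<open>p - 1\<close>, so the exponent \<open>k + m\<close> becomes \<open>N\<close>. Modulo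
    \<open>p\<close>, \<open>k\<close> is \<open>a - 1\<close> and \<open>m\<close> is 1, so
    \<open>k + m\<close> is \<open>a\<close>.\<close>
  obtain m where m: "[m = 1] (mod p)" "[m = N + K * (p - 2)] (mod (p - 1))"
    using binary_chinese_remainder_nat[OF cop] by blast
  have "[int k = int (nat ((a - 1) mod int p))] (mod int p)"
    using k(1) by (simp only: cong_int_iff)
  then have k': "[int k = a - 1] (mod int p)"
    using p2 by (simp add: cong_def)
  have m': "[int m = 1] (mod int p)"
    using m(1) by (metis cong_int_iff of_nat_1)
  have n': "[int (k + m) = a] (mod int p)"
    using cong_add[OF k' m'] by simp
  have "[k + m = K + (N + K * (p - 2))] (mod (p - 1))"
    using k(2) m(2) by (rule cong_add)
  also have "K + (N + K * (p - 2)) = N + K * (p - 1)"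
    using p2 by (auto simp: le_iff_add algebra_simps)
  also have "[\<dots> = N] (mod (p - 1))"
    by (simp add: cong_def)
  finally have n: "[k + m = N] (mod (p - 1))" .
  have units: "\<not> p dvd k" "\<not> p dvd m" "\<not> p dvd k + m"
    using a cong_dvd_iff[OF k'] cong_dvd_iff[OF m(1)] cong_dvd_iff[OF n'] p2
    unfolding cons_base_def int_dvd_int_iff by auto
  have "[int (k + m) ^ (k + m) = a ^ (k + m)] (mod int p)"
    using n' by (rule cong_pow)
  also have "[a ^ (k + m) = a ^ N] (mod int p)"
    using a n by (intro cong_pow_exponent p) (auto simp: cons_base_def)
  also note NK
  also have "[- \<epsilon> * (a - 1) ^ K = - \<epsilon> * ((a - 1) ^ k * 1 ^ m)] (mod int p)"
    using a cong_pow_exponent[OF p _ cong_sym[OF k(2)], of "a - 1"]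
    by (intro cong_mult cong_refl) (simp add: cons_base_def)
  also have "[- \<epsilon> * ((a - 1) ^ k * 1 ^ m) = - \<epsilon> * (int k ^ k * int m ^ m)] (mod int p)"
    using k' m' by (intro cong_mult cong_refl cong_pow) (simp_all add: cong_sym)
  finally have 1: "[int (k + m) ^ (k + m) = - \<epsilon> * (int k ^ k * int m ^ m)] (mod int p)" .
  \<comment> \<open>The residues of \<open>k\<close> and \<open>m\<close> are prescribed only modulo
    \<open>p\<close>, which suffices for \<open>p\<close>-th powers modulo
    \<open>p ^ 2\<close>.\<close>
  have "[int (k + m) ^ p = a ^ p] (mod int p ^ 2)"
    using n' by (rule cong_pow_self_square)
  also have "[a ^ p - (a - 1) ^ p + (a - 1) ^ p = 1 ^ p + (a - 1) ^ p] (mod int p ^ 2)"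
    using a by (intro cong_add) (auto simp: cons_base_def)
  then have "[a ^ p = 1 ^ p + (a - 1) ^ p] (mod int p ^ 2)"
    by simp
  also have "[1 ^ p + (a - 1) ^ p = int m ^ p + int k ^ p] (mod int p ^ 2)"
    using k' m' by (intro cong_add cong_pow_self_square) (simp_all add: cong_sym)
  finally have 2: "[int (k + m) ^ p = int k ^ p + int m ^ p] (mod int p ^ 2)"
    by (simp add: add.commute)
  have "[int (k + m) ^ 2 - int m * int (k + m) + int m ^ 2 = a ^ 2 - 1 * a + 1 ^ 2] (mod int p)"
    by (intro cong_diff cong_add cong_mult cong_pow n' m')
  then have "\<not> int p dvd int (k + m) ^ 2 - int m * int (k + m) + int m ^ 2"
    using a by (simp add: cong_dvd_iff cons_base_def)
  then have "\<not> int p dvd (int (k + m) ^ 2 - int m * int (k + m) + int m ^ 2) div int (gcd m (k + m)) ^ 2"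
    using dvd_div_gcd_square_iff[OF p units(2), of "k + m"] by blast
  moreover have "int p ^ 2 dvd D \<epsilon> (k + m) m"
    using 1 2 by (simp only: prime_square_dvd_D_iff[OF p odd \<epsilon> units] simp_thms)
  moreover have "0 < m" "m < k + m"
    using units by (auto intro: gr0I)
  ultimately show ?thesis
    using p units(2) unfolding P_tilde_def by blast
qed

text \<open>Let \<open>d\<close> be the order of \<open>a\<close>. If \<open>d = 2 * e\<close>, then
  \<open>a ^ e\<close> is not 1 but its square is, so it is -1 modulo the prime
  \<open>p\<close>.\<close>

lemma power_cong_1_odd_or_minus_1:
  assumes p: "prime p" and a: "\<not> int p dvd a"
  shows "(\<exists>d. odd d \<and> [a ^ d = 1] (mod int p)) \<or> (\<exists>d. [a ^ d = -1] (mod int p))"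
proof -
  define P where "P d \<longleftrightarrow> d > 0 \<and> [a ^ d = 1] (mod int p)" for d
  define d where "d = (LEAST d. P d)"
  have "P (p - 1)"
    using prime_gt_1_nat[OF p] fermat_theorem_int[OF p a] by (simp add: P_def)
  then have d: "P d"
    unfolding d_def by (rule LeastI)
  show ?thesis
  proof (cases "odd d")
    case True
    then show ?thesis
      using d by (auto simp: P_def)
  next
    case False
    then obtain e where e: "d = 2 * e" "e > 0"
      using d by (auto simp: P_def elim: evenE)
    then have "\<not> P e"
      using not_less_Least[of e P] by (simp flip: d_def)
    then have "\<not> int p dvd a ^ e - 1"
      using e by (simp add: P_def cong_iff_dvd_diff)
    moreover have "int p dvd (a ^ e - 1) * (a ^ e + 1)"
    proof -
      have "(a ^ e - 1) * (a ^ e + 1) = a ^ d - 1"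
        by (simp add: e mult_2 power_add left_diff_distrib distrib_left)
      then show ?thesis
        using d by (simp add: P_def cong_iff_dvd_diff)
    qed
    ultimately have "int p dvd a ^ e + 1"
      using p by (simp add: prime_dvd_mult_iff)
    then show ?thesis
      by (auto simp: cong_iff_dvd_diff)
  qed
qed

lemma P_tilde_iff_cons_base:
  assumes \<epsilon>: "\<epsilon> = 1 \<or> \<epsilon> = -1"
  shows "p \<in> P_tilde \<epsilon> \<longleftrightarrow> prime p \<and> (\<exists>a. cons_base p a)"
proof safe
  fix a assume p: "prime p" and a: "cons_base p a"
  show "p \<in> P_tilde \<epsilon>"
  proof (cases "\<epsilon> = -1")
    case True
    then show ?thesis
      by (intro P_tilde_if_cons_base[OF \<epsilon> p a, of 0 0]) simp
  next
    case False
    then have 1: "\<epsilon> = 1"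
      using \<epsilon> by simp
    have "\<not> int p dvd a"
      using a by (simp add: cons_base_def)
    from power_cong_1_odd_or_minus_1[OF p this] show ?thesis
    proof safe
      fix d assume d: "odd d" "[a ^ d = 1] (mod int p)"
      \<comment> \<open>Here \<open>1 - a - 1 = - a\<close>, and \<open>(- a) ^ d\<close> is -1
        modulo \<open>p\<close> because \<open>d\<close> is odd.\<close>
      have "[(1 - a) ^ 0 = - \<epsilon> * (1 - a - 1) ^ d] (mod int p)"
        using d by (simp add: 1 cong_sym)
      then show ?thesis
        by (rule P_tilde_if_cons_base[OF \<epsilon> p cons_base_reflect[OF a p]])
    next
      fix d assume "[a ^ d = -1] (mod int p)"
      then show ?thesis
        by (intro P_tilde_if_cons_base[OF \<epsilon> p a, of d 0]) (simp add: 1)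
    qed
  qed
qed (use cons_base_if_P_tilde[OF \<epsilon>] in auto)

section \<open>Sixth roots of unity among the \<open>p\<close>-th powers\<close>

lemma pth_power_cong_1_iff:
  assumes p: "prime p" and y: "[y = c ^ p] (mod int p ^ 2)"
  shows "[y ^ j = 1] (mod int p ^ 2) \<longleftrightarrow> [c ^ j = 1] (mod int p)"
proof
  assume "[y ^ j = 1] (mod int p ^ 2)"
  then have *: "[y ^ j = 1] (mod int p)"
    by (rule cong_dvd_modulus) simp
  have "[y = c ^ p] (mod int p)"
    using y by (rule cong_dvd_modulus) simp
  then have "[y = c] (mod int p)"
    using cong_pow_prime_int[OF p] by (rule cong_trans)
  then show "[c ^ j = 1] (mod int p)"
    using * by (metis cong_pow cong_sym cong_trans)
next
  assume "[c ^ j = 1] (mod int p)"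
  then have "[(c ^ j) ^ p = 1 ^ p] (mod int p ^ 2)"
    by (rule cong_pow_self_square)
  moreover have "[y ^ j = (c ^ p) ^ j] (mod int p ^ 2)"
    using y by (rule cong_pow)
  ultimately show "[y ^ j = 1] (mod int p ^ 2)"
    by (metis cong_trans mult.commute power_mult power_one)
qed

text \<open>Every proper divisor of 6 divides 2 or 3.\<close>

lemma ord_eq_6_iff:
  fixes n z :: nat
  shows "ord n z = 6 \<longleftrightarrow> [z ^ 6 = 1] (mod n) \<and> \<not> [z ^ 2 = 1] (mod n) \<and> \<not> [z ^ 3 = 1] (mod n)"
proof -
  have "d dvd 6 \<Longrightarrow> d = 1 \<or> d = 2 \<or> d = 3 \<or> d = 6" for d :: nat
  proof -
    assume "d dvd 6"
    moreover from this have "d \<le> 6"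
      by (intro dvd_imp_le) auto
    then have "d \<in> {0, 1, 2, 3, 4, 5, 6}"
      by auto
    ultimately show ?thesis
      by auto
  qed
  then show ?thesis
    unfolding ord_divides by fastforce
qed

lemma ord_pth_power_eq_6_imp_dvd:
  assumes p: "prime p" and z: "[int z = c ^ p] (mod int p ^ 2)" and "ord (p ^ 2) z = 6"
  shows "int p dvd c ^ 2 - c + 1"
proof -
  have "[z ^ j = 1] (mod p ^ 2) \<longleftrightarrow> int p dvd c ^ j - 1" for j
    using pth_power_cong_1_iff[OF p z, of j] cong_int_iff[of "z ^ j" 1 "p ^ 2"]
    by (simp add: cong_iff_dvd_diff)
  then have "int p dvd c ^ 6 - 1" "\<not> int p dvd c ^ 2 - 1" "\<not> int p dvd c ^ 3 - 1"
    using assms(3) by (simp_all add: ord_eq_6_iff)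
  \<comment> \<open>The factors \<open>c ^ 3 - 1\<close> and \<open>c + 1\<close> are prime to
    \<open>p\<close>, which leaves the cyclotomic one.\<close>
  moreover have "c ^ 6 - 1 = (c ^ 3 - 1) * ((c + 1) * (c ^ 2 - c + 1))"
      "c ^ 2 - 1 = (c - 1) * (c + 1)"
    by (simp_all add: algebra_simps eval_nat_numeral)
  ultimately show ?thesis
    using p by (simp add: prime_dvd_mult_iff)
qed

text \<open>The prime 3 is exceptional: modulo 3 the root of \<open>c ^ 2 - c + 1\<close> is 2,
  which has order 2.\<close>

lemma ord_pth_power_eq_6_if_dvd:
  assumes p: "prime p" "p \<noteq> 3" and z: "[int z = c ^ p] (mod int p ^ 2)"
    and c: "int p dvd c ^ 2 - c + 1"
  shows "ord (p ^ 2) z = 6"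
proof -
  have *: "[z ^ j = 1] (mod p ^ 2) \<longleftrightarrow> int p dvd c ^ j - 1" for j
    using pth_power_cong_1_iff[OF p(1) z, of j] cong_int_iff[of "z ^ j" 1 "p ^ 2"]
    by (simp add: cong_iff_dvd_diff)
  have "c ^ 6 - 1 = (c ^ 3 - 1) * (c + 1) * (c ^ 2 - c + 1)"
    by (simp add: algebra_simps eval_nat_numeral)
  then have "int p dvd c ^ 6 - 1"
    using c by simp
  moreover have "\<not> int p dvd c ^ 2 - 1"
  proof
    assume d: "int p dvd c ^ 2 - 1"
    \<comment> \<open>The inner difference is \<open>c - 2\<close>, and
      \<open>(c ^ 2 - 1) - (c - 2) * (c + 2) = 3\<close>.\<close>
    have "int p dvd (c ^ 2 - 1) - ((c ^ 2 - 1) - (c ^ 2 - c + 1)) * (c + 2)"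
      by (rule dvd_diff[OF d dvd_mult2[OF dvd_diff[OF d c]]])
    then have "int p dvd 3"
      by (simp add: algebra_simps eval_nat_numeral)
    then have "p dvd 3"
      by (metis int_dvd_int_iff of_nat_numeral)
    then show False
      using p primes_dvd_imp_eq[of p 3] by simp
  qed
  moreover have "\<not> int p dvd c ^ 3 - 1"
  proof
    assume d: "int p dvd c ^ 3 - 1"
    have "int p dvd (c + 1) * (c ^ 2 - c + 1) - (c ^ 3 - 1)"
      by (rule dvd_diff[OF dvd_mult[OF c] d])
    then have "int p dvd 2"
      by (simp add: algebra_simps eval_nat_numeral)
    then have "p dvd 2"
      by (metis int_dvd_int_iff of_nat_numeral)
    then have "p = 2"
      using p primes_dvd_imp_eq[of p 2] by simp
    \<comment> \<open>The value \<open>c ^ 2 - c + 1\<close> is always odd.\<close>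
    then show False
      using c by simp
  qed
  ultimately show ?thesis
    by (simp only: ord_eq_6_iff * simp_thms)
qed

section \<open>Comparison with \<open>P_cons_tilde\<close>\<close>

lemma P_cons_tilde_if_cons_base:
  assumes p: "prime p" and a: "cons_base p a"
  shows "p \<in> P_cons_tilde"
proof -
  have odd: "odd p"
    using a p by (rule cons_base_odd)
  have diff: "[a ^ p - (a - 1) ^ p = 1] (mod int p ^ 2)"
    using a by (simp add: cons_base_def)
  have "\<not> sixth_root_pair p ((a - 1) ^ p) (a ^ p)"
  proof
    assume "sixth_root_pair p ((a - 1) ^ p) (a ^ p)"
    then consider z where "ord (p ^ 2) z = 6" "[a ^ p = int z] (mod int p ^ 2)"
      | z where "[a ^ p = int z - 1] (mod int p ^ 2)" "[(a - 1) ^ p = int z] (mod int p ^ 2)"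
      unfolding sixth_root_pair_def by blast
    then show False
    proof cases
      case 1
      then have "int p dvd a ^ 2 - a + 1"
        by (intro ord_pth_power_eq_6_imp_dvd[OF p cong_sym])
      then show False
        using a by (simp add: cons_base_def)
    next
      case 2
      \<comment> \<open>In this orientation the difference is both 1 and -1, which is impossible for
        odd \<open>p\<close>.\<close>
      then have "[1 = int z - 1 - int z] (mod int p ^ 2)"
        using diff by (metis cong_diff cong_sym cong_trans)
      then have "int p ^ 2 dvd 2"
        by (simp add: cong_iff_dvd_diff)
      then have "int p dvd 2"
        by (metis dvd_power dvd_trans pos2)
      then have "p dvd 2"
        by (metis int_dvd_int_iff of_nat_numeral)
      then show False
        using p odd primes_dvd_imp_eq[of p 2] by simp
    qed
  qed
  moreover have "nonzero_pth_power p ((a - 1) ^ p)" "nonzero_pth_power p (a ^ p)"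
    using a p by (auto intro: cong_refl simp: nonzero_pth_power_def cons_base_def dest!: prime_int_dvd_powerD[OF p])
  moreover have "consecutive p ((a - 1) ^ p) (a ^ p)"
    using diff by (simp add: consecutive_def)
  ultimately show ?thesis
    using p unfolding P_cons_tilde_def by blast
qed

lemma cons_base_if_P_cons_tilde:
  assumes "p \<in> P_cons_tilde"
  shows "prime p \<and> (\<exists>a. cons_base p a)"
proof -
  obtain x y where p: "prime p" and pow: "nonzero_pth_power p x" "nonzero_pth_power p y"
    and diff: "[y - x = 1] (mod int p ^ 2)" and sixth: "\<not> sixth_root_pair p x y"
  proof -
    from assms obtain x y where *: "prime p" "nonzero_pth_power p x" "nonzero_pth_power p y"
      "consecutive p x y" "\<not> sixth_root_pair p x y"
      by (auto simp: P_cons_tilde_def)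
    \<comment> \<open>If the difference is -1, \<open>x\<close> and \<open>y\<close> are
      interchanged.\<close>
    have sym: "\<not> sixth_root_pair p y x"
      using *(5) unfolding sixth_root_pair_def by blast
    have "[y - x = 1] (mod int p ^ 2) \<or> [x - y = 1] (mod int p ^ 2)"
      using *(4) cong_minus_minus_iff[of "y - x" "-1" "int p ^ 2"] by (auto simp: consecutive_def)
    then show ?thesis
      using * sym that by blast
  qed
  obtain a c where a: "[y = a ^ p] (mod int p ^ 2)" and c: "[x = c ^ p] (mod int p ^ 2)"
    and xy: "\<not> int p dvd x" "\<not> int p dvd y"
    using pow unfolding nonzero_pth_power_def by blast
  have mod_p: "[u = v] (mod int p)" if "[u = v] (mod int p ^ 2)" for u v
    using that by (rule cong_dvd_modulus) simp
  have a': "[y = a] (mod int p)" and c': "[x = c] (mod int p)"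
    using mod_p[OF a] mod_p[OF c] cong_pow_prime_int[OF p] cong_trans by blast+
  have "[y - (y - x) = a - 1] (mod int p)"
    using a' mod_p[OF diff] by (rule cong_diff)
  then have x: "[x = a - 1] (mod int p)"
    by simp
  \<comment> \<open>The bases \<open>a\<close> and \<open>c\<close> are unrelated at first; modulo
    \<open>p\<close> they differ by 1, so \<open>a - 1\<close> may replace \<open>c\<close> in the
    \<open>p\<close>-th power.\<close>
  then have "[c = a - 1] (mod int p)"
    using c' by (metis cong_sym cong_trans)
  then have "[c ^ p = (a - 1) ^ p] (mod int p ^ 2)"
    by (rule cong_pow_self_square)
  then have "[y - x = a ^ p - (a - 1) ^ p] (mod int p ^ 2)"
    using a c by (metis cong_diff cong_trans)
  then have a_diff: "[a ^ p - (a - 1) ^ p = 1] (mod int p ^ 2)"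
    using diff by (metis cong_sym cong_trans)
  have units: "\<not> int p dvd a" "\<not> int p dvd a - 1"
    using xy by (simp_all flip: cong_dvd_iff[OF a'] cong_dvd_iff[OF x])
  \<comment> \<open>For \<open>p = 3\<close>, 9 would divide \<open>3 * (a * (a - 1))\<close>,
    although \<open>a\<close> and \<open>a - 1\<close> are units.\<close>
  have "p \<noteq> 3"
  proof
    assume "p = 3"
    then have "3 * 3 dvd a ^ 3 - (a - 1) ^ 3 - 1"
      using a_diff by (simp add: cong_iff_dvd_diff)
    also have "a ^ 3 - (a - 1) ^ 3 - 1 = 3 * (a * (a - 1))"
      by (simp add: algebra_simps eval_nat_numeral)
    finally have "int p dvd a * (a - 1)"
      using \<open>p = 3\<close> by (simp only: dvd_times_left_cancel_iff) simp
    then show False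
      using units p by (simp add: prime_dvd_mult_iff)
  qed
  have "\<not> int p dvd a ^ 2 - a + 1"
  proof
    assume dvd: "int p dvd a ^ 2 - a + 1"
    \<comment> \<open>\<open>ord\<close> takes natural numbers, so \<open>y\<close> is replaced by
      its least nonnegative residue.\<close>
    define z where "z = nat (y mod int p ^ 2)"
    have "int z = y mod int p ^ 2"
      using prime_gt_0_nat[OF p] by (simp add: z_def)
    then have z: "[y = int z] (mod int p ^ 2)"
      by (simp add: cong_def)
    have "[int z = a ^ p] (mod int p ^ 2)"
      using z a by (metis cong_sym cong_trans)
    then have "ord (p ^ 2) z = 6"
      using dvd by (intro ord_pth_power_eq_6_if_dvd p \<open>p \<noteq> 3\<close>)
    moreover have "[y - (y - x) = int z - 1] (mod int p ^ 2)"
      using z diff by (rule cong_diff)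
    ultimately show False
      using sixth z unfolding sixth_root_pair_def by auto
  qed
  then show ?thesis
    using p units a_diff by (auto simp: cons_base_def)
qed

theorem theorem4p6:
  shows "P_tilde 1 = P_tilde (-1) \<and> P_tilde (-1) = P_cons_tilde"
  using P_tilde_iff_cons_base[of 1] P_tilde_iff_cons_base[of "-1"]
    P_cons_tilde_if_cons_base cons_base_if_P_cons_tilde by blast

end
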